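(* Let $K$ be an infinite field of characteristic different from $2$ and $3$, and let $(A,\omega)$ be a Bernstein algebra over $K$ with barideal $N=\ker(\omega)$. Then the following conditions are equivalent: (i) $A$ satisfies the ascending chain condition on subalgebras; (ii) $A$ satisfies the ascending chain condition on subalgebras contained in $N$; (iii) $A$ is finite-dimensional over $K$. The same three conditions are also equivalent when "ascending chain condition" is replaced in both (i) and (ii) by "descending chain condition".
   Context: Algebras over $K$ are not assumed associative, unital or finite-dimensional. A baric algebra over $K$ is a pair $(A,\omega)$ where $A$ is a $K$-algebra and $\omega:A\to K$ is a nonzero homomorphism of $K$-algebras (the weight function); its barideal is $\ker(\omega)$. A Bernstein algebra is a commutative baric algebra $(A,\omega)$ satisfying $(x^2)^2=\omega(x)^2x^2$ for all $x\in A$. The ascending (descending) chain condition on a family of subalgebras means that there is no infinite strictly ascending (descending) chain of subalgebras belonging to the family. *)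

theory Defs
  imports "HOL-Computational_Algebra.Computational_Algebra"
begin

locale nonassoc_algebra = vector_space scale
  for scale :: "'k::field \<Rightarrow> 'a::ab_group_add \<Rightarrow> 'a" (infixr \<open>*s\<close> 75) +
  fixes mult :: "'a \<Rightarrow> 'a \<Rightarrow> 'a" (infixl \<open>\<bullet>\<close> 70)
  assumes linear_mult_right: "Vector_Spaces.linear scale scale (\<lambda>y. x \<bullet> y)"
    and linear_mult_left: "Vector_Spaces.linear scale scale (\<lambda>x. x \<bullet> y)"
begin

definition subalgebra :: "'a set \<Rightarrow> bool"
  where "subalgebra S \<longleftrightarrow> subspace S \<and> (\<forall>x\<in>S. \<forall>y\<in>S. x \<bullet> y \<in> S)"

definition finite_dimensional :: bool
  where "finite_dimensional \<longleftrightarrow> (\<exists>B. finite_dimensional_vector_space scale B)"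

end

locale baric_algebra = nonassoc_algebra scale mult
  for scale :: "'k::field \<Rightarrow> 'a::ab_group_add \<Rightarrow> 'a" (infixr \<open>*s\<close> 75)
    and mult :: "'a \<Rightarrow> 'a \<Rightarrow> 'a" (infixl \<open>\<bullet>\<close> 70) +
  fixes weight :: "'a \<Rightarrow> 'k" (\<open>\<omega>\<close>)
  assumes linear_weight: "Vector_Spaces.linear scale (*) \<omega>"
    and weight_mult: "\<omega> (x \<bullet> y) = \<omega> x * \<omega> y"
    and weight_nonzero: "\<exists>x. \<omega> x \<noteq> 0"
begin

definition barideal :: "'a set"
  where "barideal = {x. \<omega> x = 0}"

end

locale bernstein_algebra = baric_algebra scale mult weight
  for scale :: "'k::field \<Rightarrow> 'a::ab_group_add \<Rightarrow> 'a" (infixr \<open>*s\<close> 75)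
    and mult :: "'a \<Rightarrow> 'a \<Rightarrow> 'a" (infixl \<open>\<bullet>\<close> 70)
    and weight :: "'a \<Rightarrow> 'k" (\<open>\<omega>\<close>) +
  assumes mult_commute: "x \<bullet> y = y \<bullet> x"
    and bernstein: "(x \<bullet> x) \<bullet> (x \<bullet> x) = (\<omega> x)\<^sup>2 *s (x \<bullet> x)"

definition ascending_chain_condition :: "'a set set \<Rightarrow> bool"
  where "ascending_chain_condition F \<longleftrightarrow>
    \<not> (\<exists>C :: nat \<Rightarrow> 'a set. \<forall>n. C n \<in> F \<and> C n \<subset> C (Suc n))"

definition descending_chain_condition :: "'a set set \<Rightarrow> bool"
  where "descending_chain_condition F \<longleftrightarrow>
    \<not> (\<exists>C :: nat \<Rightarrow> 'a set. \<forall>n. C n \<in> F \<and> C (Suc n) \<subset> C n)"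

end

theory Submission
  imports Defs
begin

text \<open>
  A chain condition controls every \<^emph>\<open>zero section\<close>: if \<open>W \<subseteq> S\<close> are subalgebras inside the barideal
  \<open>N\<close> and all products of elements of \<open>S\<close> lie in \<open>W\<close>, then every subspace between \<open>W\<close> and \<open>S\<close> is
  a subalgebra, so \<open>W\<close> has finite codimension in \<open>S\<close> as soon as either chain condition holds for the
  subalgebras in \<open>N\<close> (\<open>chain_condition_imp_finite_modulo\<close>). An element of weight \<open>1\<close> has an idempotent
  square \<open>e\<close>, and \<open>N\<close> is the sum of the Peirce spaces \<open>U\<close> and \<open>V\<close>, on which \<open>e\<close> acts as \<open>1/2\<close> and \<open>0\<close>.
  The defining identity of degree four, expanded at \<open>e + t n\<close>, gives \<open>U U \<subseteq> V\<close>, \<open>U V \<subseteq> U\<close>,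
  \<open>V V \<subseteq> U\<close> and a few identities between products of elements of \<open>U\<close> and \<open>V\<close>.
  
  Three zero sections suffice. Let \<open>annU\<close> be the set of those elements of \<open>U\<close> that annihilate \<open>U\<close>.
  Its products vanish, so it is finite-dimensional. It contains \<open>V V\<close> and absorbs multiplication by
  \<open>V\<close>, so \<open>annU + V\<close> over \<open>annU\<close> is a zero section and \<open>V\<close> is finite-dimensional. Finally \<open>N\<close>
  over the span of \<open>N N\<close> is a zero section; looking at components in \<open>U\<close>, this says that \<open>U\<close> is,
  up to finitely many dimensions, spanned by \<open>annU\<close> and \<open>U V\<close>.
  
  Modulo \<open>annU\<close>, multiplications by elements of \<open>V\<close> anticommute and have square zero on \<open>U\<close>. Thus
  \<open>U\<close> modulo \<open>annU\<close> is a module over the exterior algebra of the finite-dimensional space \<open>V\<close>, and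
  \<open>U V\<close> has finite codimension in it. The augmentation ideal of that algebra is nilpotent, so
  \<open>U\<close> is finite-dimensional, as in Nakayama's lemma. Here the generators of \<open>V\<close> are removed one
  at a time (\<open>finite_modulo_eliminate\<close>). Hence \<open>V\<close>, \<open>U\<close> and with them the whole algebra are
  finite-dimensional. Conversely, in a finite-dimensional space the dimension is strictly monotone
  on subspaces, which excludes infinite chains.
\<close>

section \<open>Finite codimension and chains of subspaces\<close>

text \<open>
  Finite codimension is phrased for arbitrary sets instead of quotient spaces: it is then a preorder
  that is compatible with unions and linear images.
\<close>

locale linear_space = vector_space scale
  for scale :: "'k::field \<Rightarrow> 'b::ab_group_add \<Rightarrow> 'b" (infixr \<open>*s\<close> 75)
begin

definition finite_modulo :: "'b set \<Rightarrow> 'b set \<Rightarrow> bool"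
  where "finite_modulo X Y \<longleftrightarrow> (\<exists>F. finite F \<and> X \<subseteq> span (F \<union> Y))"

lemma finite_modulo_span: "X \<subseteq> span Y \<Longrightarrow> finite_modulo X Y"
  unfolding finite_modulo_def by (rule exI[of _ "{}"]) simp

lemma finite_modulo_trans:
  assumes "finite_modulo X Y" "finite_modulo Y Z"
  shows "finite_modulo X Z"
proof -
  obtain F G where F: "finite F" "X \<subseteq> span (F \<union> Y)" and G: "finite G" "Y \<subseteq> span (G \<union> Z)"
    using assms unfolding finite_modulo_def by blast
  have "F \<union> Y \<subseteq> span (F \<union> G \<union> Z)"
    using G(2) span_mono[of "G \<union> Z" "F \<union> G \<union> Z"] span_superset[of "F \<union> G \<union> Z"] by blast
  then have "X \<subseteq> span (F \<union> G \<union> Z)"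
    using F(2) span_minimal[OF _ subspace_span] by blast
  then show ?thesis
    unfolding finite_modulo_def using F(1) G(1) by (metis finite_UnI)
qed

lemma finite_modulo_Un:
  assumes "finite_modulo X Z" "finite_modulo Y Z"
  shows "finite_modulo (X \<union> Y) Z"
proof -
  obtain F G where F: "finite F" "X \<subseteq> span (F \<union> Z)" and G: "finite G" "Y \<subseteq> span (G \<union> Z)"
    using assms unfolding finite_modulo_def by blast
  have "X \<union> Y \<subseteq> span (F \<union> G \<union> Z)"
    using F(2) G(2) span_mono[of "F \<union> Z" "F \<union> G \<union> Z"] span_mono[of "G \<union> Z" "F \<union> G \<union> Z"] by blast
  then show ?thesis
    unfolding finite_modulo_def using F(1) G(1) by (metis finite_UnI)
qed

lemma finite_modulo_image:
  assumes "finite_modulo X Y" and f: "Vector_Spaces.linear scale scale f"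
  shows "finite_modulo (f ` X) (f ` Y)"
proof -
  interpret f: Vector_Spaces.linear scale scale f by (rule f)
  obtain F where F: "finite F" "X \<subseteq> span (F \<union> Y)"
    using assms unfolding finite_modulo_def by blast
  have "f ` X \<subseteq> span (f ` F \<union> f ` Y)"
    using F(2) by (metis f.span_image image_Un image_mono)
  then show ?thesis
    unfolding finite_modulo_def using F(1) by blast
qed

text \<open>
  If the codimension is infinite, a basis of \<open>W\<close> extends to a basis of \<open>S\<close> by infinitely many
  vectors. Choosing a sequence of them embeds the subsets of the natural numbers, ordered by
  inclusion, into the subspaces between \<open>W\<close> and \<open>S\<close>; initial segments give an ascending
  chain and final segments a descending one.
\<close>

lemma chain_condition_imp_finite_modulo:
  assumes W: "subspace W" "W \<subseteq> S" and S: "subspace S"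
    and between: "\<And>T. subspace T \<Longrightarrow> W \<subseteq> T \<Longrightarrow> T \<subseteq> S \<Longrightarrow> T \<in> \<F>"
    and chain: "ascending_chain_condition \<F> \<or> descending_chain_condition \<F>"
  shows "finite_modulo S W"
proof (rule ccontr)
  assume infinite_codim: "\<not> finite_modulo S W"
  obtain B\<^sub>W where BW: "B\<^sub>W \<subseteq> W" "independent B\<^sub>W" "W \<subseteq> span B\<^sub>W"
    using maximal_independent_subset by blast
  obtain B where B: "B\<^sub>W \<subseteq> B" "B \<subseteq> S" "independent B" "S \<subseteq> span B"
    using maximal_independent_subset_extend[of B\<^sub>W S] BW W by blast
  have "infinite (B - B\<^sub>W)"
  proof
    assume fin: "finite (B - B\<^sub>W)"
    have "B \<subseteq> (B - B\<^sub>W) \<union> W" using BW(1) by blast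
    then have "S \<subseteq> span ((B - B\<^sub>W) \<union> W)" using B(4) span_mono by blast
    with fin infinite_codim show False unfolding finite_modulo_def by blast
  qed
  then obtain s :: "nat \<Rightarrow> 'b" where s: "inj s" "range s \<subseteq> B - B\<^sub>W"
    using infinite_countable_subset by blast
  define D where "D I = span (B\<^sub>W \<union> s ` I)" for I
  have mem: "D I \<in> \<F>" for I
  proof (rule between)
    show "subspace (D I)" unfolding D_def by simp
    show "W \<subseteq> D I" unfolding D_def using BW(3) span_mono[of B\<^sub>W "B\<^sub>W \<union> s ` I"] by blast
    have "B\<^sub>W \<union> s ` I \<subseteq> S" using B(1,2) s(2) by blast
    then show "D I \<subseteq> S" unfolding D_def by (rule span_minimal[OF _ S])
  qed
  have strict: "D I \<subset> D J" if IJ: "I \<subset> J" for I J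
  proof -
    obtain j where j: "j \<in> J" "j \<notin> I" using IJ by blast
    have "B\<^sub>W \<union> s ` I \<subseteq> B - {s j}"
      using B(1) s j by (auto simp: inj_eq)
    then have "D I \<subseteq> span (B - {s j})" unfolding D_def by (rule span_mono)
    moreover have "s j \<notin> span (B - {s j})"
      using B(3) s(2) unfolding dependent_def by blast
    moreover have "s j \<in> D J" unfolding D_def using j(1) by (simp add: span_base)
    moreover have "D I \<subseteq> D J" unfolding D_def using IJ by (intro span_mono) auto
    ultimately show ?thesis by blast
  qed
  have "\<not> ascending_chain_condition \<F>"
    unfolding ascending_chain_condition_def using mem
    by (auto intro!: exI[of _ "\<lambda>n. D {..<n}"] strict)
  moreover have "\<not> descending_chain_condition \<F>"
    unfolding descending_chain_condition_def using mem
    by (auto intro!: exI[of _ "\<lambda>n. D {n..}"] strict)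
  ultimately show False using chain by blast
qed

text \<open>
  Only the values at \<open>1\<close>, \<open>- 1\<close>, \<open>2\<close> and \<open>- 2\<close> are evaluated: the resulting linear system has a
  determinant with prime divisors \<open>2\<close> and \<open>3\<close> only.
\<close>

lemma quartic_coeffs_zero:
  assumes two: "(2::'k) \<noteq> 0" and three: "(3::'k) \<noteq> 0"
    and vanish: "\<And>t. t *s a + t ^ 2 *s b + t ^ 3 *s c + t ^ 4 *s d = 0"
  shows "a = 0" "b = 0" "c = 0" "d = 0"
proof -
  have twice: "x = 0" if "x + x = 0" for x :: 'b
  proof -
    have "(2::'k) *s x = 0" using that scale_left_distrib[of 1 1 x] by simp
    then show ?thesis using two by simp
  qed
  have p1: "a + b + c + d = 0" using vanish[of 1] by simp
  have m1: "- a + b - c + d = 0" using vanish[of "-1"] by simp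
  have "(b + d) + (b + d) = (a + b + c + d) + (- a + b - c + d)" by (simp add: algebra_simps)
  then have bd: "b + d = 0" using p1 m1 by (metis add_0_left twice)
  have "(a + c) + (b + d) = a + b + c + d" by (simp add: ac_simps)
  then have ac: "a + c = 0" using p1 bd by simp
  have c: "c = - a" using minus_unique[OF ac] by simp
  have d: "d = - b" using minus_unique[OF bd] by simp
  have six: "(6::'k) \<noteq> 0" using two three mult_eq_0_iff[of 2 "3::'k"] by simp
  have twelve: "(12::'k) \<noteq> 0" using two six mult_eq_0_iff[of 2 "6::'k"] by simp
  have at: "(t - t ^ 3) *s a + (t ^ 2 - t ^ 4) *s b = 0" for t
    using vanish[of t] unfolding c d by (simp add: algebra_simps)
  have p2: "(-6) *s a + (-12) *s b = 0" using at[of 2] by simp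
  have m2: "6 *s a + (-12) *s b = 0" using at[of "-2"] by simp
  have "6 *s a + 6 *s a = (6 *s a + (-12) *s b) - ((-6) *s a + (-12) *s b)" by simp
  then have "6 *s a = 0" using p2 m2 by (metis diff_zero twice)
  then show a: "a = 0" using six by simp
  show b: "b = 0" using m2 twelve a by simp
  show "c = 0" "d = 0" using c d a b by simp_all
qed

end

sublocale nonassoc_algebra \<subseteq> linear_space ..

lemma (in finite_dimensional_vector_space) subspace_chain_conditions:
  assumes "\<And>S. S \<in> \<F> \<Longrightarrow> subspace S"
  shows "ascending_chain_condition \<F>" "descending_chain_condition \<F>"
proof -
  have strict: "dim S < dim T" if "S \<in> \<F>" "T \<in> \<F>" "S \<subset> T" for S T
    using that assms by (metis dim_psubset span_eq_iff)
  show "ascending_chain_condition \<F>"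
    unfolding ascending_chain_condition_def
  proof (rule notI, elim exE)
    fix C :: "nat \<Rightarrow> 'b set"
    assume C: "\<forall>n. C n \<in> \<F> \<and> C n \<subset> C (Suc n)"
    then have "strict_mono (\<lambda>n. dim (C n))"
      unfolding strict_mono_Suc_iff using strict by blast
    then have "Suc dimension \<le> dim (C (Suc dimension))"
      by (rule strict_mono_imp_increasing)
    then show False using dim_subset_UNIV[of "C (Suc dimension)"] by linarith
  qed
  show "descending_chain_condition \<F>"
    unfolding descending_chain_condition_def
  proof (rule notI, elim exE)
    fix C :: "nat \<Rightarrow> 'b set"
    assume C: "\<forall>n. C n \<in> \<F> \<and> C (Suc n) \<subset> C n"
    then have "\<exists>f. \<forall>n. (f (Suc n), f n) \<in> less_than"
      using strict by (intro exI[of _ "\<lambda>n. dim (C n)"]) simp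
    then show False using wf_less_than unfolding wf_iff_no_infinite_down_chain by blast
  qed
qed

section \<open>Peirce decomposition of a Bernstein algebra\<close>

locale bernstein_idempotent = bernstein_algebra scale mult weight
  for scale :: "'k::field \<Rightarrow> 'a::ab_group_add \<Rightarrow> 'a" (infixr \<open>*s\<close> 75)
    and mult :: "'a \<Rightarrow> 'a \<Rightarrow> 'a" (infixl \<open>\<bullet>\<close> 70)
    and weight :: "'a \<Rightarrow> 'k" (\<open>\<omega>\<close>) +
  fixes e :: 'a
  assumes idem: "e \<bullet> e = e" and weight_e: "\<omega> e = 1"
    and two: "(2::'k) \<noteq> 0" and three: "(3::'k) \<noteq> 0"
begin

sublocale left: Vector_Spaces.linear scale scale "\<lambda>y. x \<bullet> y" for x
  by (rule linear_mult_right)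

sublocale right: Vector_Spaces.linear scale scale "\<lambda>x. x \<bullet> y" for y
  by (rule linear_mult_left)

sublocale weight: Vector_Spaces.linear scale "(*)" \<omega>
  by (rule linear_weight)

lemmas mult_simps = left.add right.add left.diff right.diff left.neg right.neg
  left.scale right.scale left.zero right.zero

lemma four: "(4::'k) \<noteq> 0"
  using two mult_eq_0_iff[of 2 "2::'k"] by simp

lemma twice_eq_0: "x + x = 0 \<Longrightarrow> x = 0" for x :: 'a
proof -
  assume "x + x = 0"
  then have "(2::'k) *s x = 0" using scale_left_distrib[of 1 1 x] by simp
  then show ?thesis using two by simp
qed

lemma square_sum3:
  "(a + b + c) \<bullet> (a + b + c) =
     a \<bullet> a + b \<bullet> b + c \<bullet> c + 2 *s (a \<bullet> b) + 2 *s (a \<bullet> c) + 2 *s (b \<bullet> c)"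
proof -
  have "2 *s x = x + x" for x using scale_left_distrib[of 1 1 x] by simp
  then show ?thesis
    by (simp add: mult_simps mult_commute[of b a] mult_commute[of c a] mult_commute[of c b] ac_simps)
qed

lemma weight_barideal: "n \<in> barideal \<longleftrightarrow> \<omega> n = 0"
  by (simp add: barideal_def)

lemma subspace_barideal: "subspace barideal"
  by (auto simp: subspace_def weight_barideal weight.add weight.scale weight.zero)

text \<open>
  The element \<open>e + t n\<close> has weight \<open>1\<close> for all scalars \<open>t\<close>, so its square is idempotent. The four
  identities are the coefficients of \<open>t\<close>, \<open>t\<^sup>2\<close>, \<open>t\<^sup>3\<close> and \<open>t\<^sup>4\<close> in this equation.
\<close>

lemma bernstein_expansion:
  assumes "n \<in> barideal"
  shows "2 *s (e \<bullet> (e \<bullet> n)) = e \<bullet> n"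
    and "4 *s ((e \<bullet> n) \<bullet> (e \<bullet> n)) + 2 *s (e \<bullet> (n \<bullet> n)) = n \<bullet> n"
    and "(e \<bullet> n) \<bullet> (n \<bullet> n) = 0"
    and "(n \<bullet> n) \<bullet> (n \<bullet> n) = 0"
proof -
  define p q where "p = e \<bullet> n" and "q = n \<bullet> n"
  have vanish: "t *s (4 *s (e \<bullet> p) - 2 *s p) + t ^ 2 *s (4 *s (p \<bullet> p) + 2 *s (e \<bullet> q) - q)
      + t ^ 3 *s (4 *s (p \<bullet> q)) + t ^ 4 *s (q \<bullet> q) = 0" for t
  proof -
    define x where "x = e + t *s n"
    have "\<omega> x = 1" using assms
      by (simp add: x_def weight.add weight.scale weight_e weight_barideal)
    then have eq: "(x \<bullet> x) \<bullet> (x \<bullet> x) = x \<bullet> x" using bernstein[of x] by simp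
    have xx: "x \<bullet> x = e + (2 * t) *s p + t ^ 2 *s q"
      using square_sum3[of e "t *s n" 0]
      by (simp add: x_def mult_simps idem p_def q_def power2_eq_square)
    have square: "(x \<bullet> x) \<bullet> (x \<bullet> x) = e + (4 * t ^ 2) *s (p \<bullet> p) + t ^ 4 *s (q \<bullet> q)
       + (4 * t) *s (e \<bullet> p) + (2 * t ^ 2) *s (e \<bullet> q) + (4 * t ^ 3) *s (p \<bullet> q)"
    proof -
      have powers: "2 * t * (2 * t) = 4 * t ^ 2" "t ^ 2 * t ^ 2 = t ^ 4" "2 * (2 * t) = 4 * t"
        "2 * (t ^ 2 * (2 * t)) = 4 * t ^ 3"
        by (simp_all add: power2_eq_square power3_eq_cube power4_eq_xxxx)
      show ?thesis
        unfolding xx square_sum3 left.scale right.scale scale_scale powers idem by (rule refl)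
    qed
    have "t *s (4 *s (e \<bullet> p) - 2 *s p) + t ^ 2 *s (4 *s (p \<bullet> p) + 2 *s (e \<bullet> q) - q)
      + t ^ 3 *s (4 *s (p \<bullet> q)) + t ^ 4 *s (q \<bullet> q) = (x \<bullet> x) \<bullet> (x \<bullet> x) - x \<bullet> x"
      unfolding square unfolding xx by (simp add: algebra_simps)
    then show ?thesis using eq by simp
  qed
  note coeffs = quartic_coeffs_zero[OF two three vanish]
  have "2 *s (2 *s (e \<bullet> p) - p) = 0" using coeffs(1) by (simp add: scale_right_diff_distrib)
  then show "2 *s (e \<bullet> (e \<bullet> n)) = e \<bullet> n" using two unfolding p_def by simp
  show "4 *s ((e \<bullet> n) \<bullet> (e \<bullet> n)) + 2 *s (e \<bullet> (n \<bullet> n)) = n \<bullet> n"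
    using coeffs(2) unfolding p_def q_def by simp
  show "(e \<bullet> n) \<bullet> (n \<bullet> n) = 0"
    using coeffs(3) four unfolding p_def q_def by simp
  show "(n \<bullet> n) \<bullet> (n \<bullet> n) = 0"
    using coeffs(4) unfolding q_def by simp
qed

definition U :: "'a set" where "U = {u. \<omega> u = 0 \<and> 2 *s (e \<bullet> u) = u}"
definition V :: "'a set" where "V = {v. \<omega> v = 0 \<and> e \<bullet> v = 0}"

lemma subspace_U: "subspace U"
proof -
  have "2 *s (e \<bullet> (c *s x)) = c *s x" if "2 *s (e \<bullet> x) = x" for c x
    using that scale_left_commute[of 2 c "e \<bullet> x"] by (simp only: left.scale)
  then show ?thesis
    by (simp add: subspace_def U_def weight.add weight.scale weight.zero left.add left.zero
        scale_right_distrib)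
qed

lemma subspace_V: "subspace V"
  by (auto simp: subspace_def V_def weight.add weight.scale weight.zero mult_simps)

lemmas U_closed = subspace_add[OF subspace_U] subspace_neg[OF subspace_U] subspace_scale[OF subspace_U]
lemmas V_closed = subspace_add[OF subspace_V] subspace_neg[OF subspace_V] subspace_scale[OF subspace_V]

lemma U_barideal: "u \<in> U \<Longrightarrow> u \<in> barideal" and V_barideal: "v \<in> V \<Longrightarrow> v \<in> barideal"
  by (simp_all add: U_def V_def weight_barideal)

lemma Peirce_split:
  assumes "n \<in> barideal"
  obtains u v where "u \<in> U" "v \<in> V" "n = u + v"
proof
  have w: "\<omega> (e \<bullet> n) = 0" using assms by (simp add: weight_mult weight_barideal)
  show "2 *s (e \<bullet> n) \<in> U"
    using w bernstein_expansion(1)[OF assms] by (simp add: U_def weight.scale mult_simps)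
  show "n - 2 *s (e \<bullet> n) \<in> V"
    using w assms bernstein_expansion(1)[OF assms]
    by (simp add: V_def weight.scale weight.diff mult_simps weight_barideal)
  show "n = 2 *s (e \<bullet> n) + (n - 2 *s (e \<bullet> n))" by simp
qed

lemma U_Int_V: "x \<in> U \<Longrightarrow> x \<in> V \<Longrightarrow> x = 0"
  by (auto simp: U_def V_def)

text \<open>
  This polarizes the second identity of \<open>bernstein_expansion\<close>. Since \<open>2 e\<close> acts as the identity on
  \<open>U\<close> and as zero on \<open>V\<close>, it tells where the products of Peirce components lie.
\<close>

lemma square_expansion_polarized:
  assumes "n \<in> barideal" "m \<in> barideal"
  shows "(2 *s (e \<bullet> n)) \<bullet> (2 *s (e \<bullet> m)) + 2 *s (e \<bullet> (n \<bullet> m)) = n \<bullet> m"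
proof -
  define B where "B x y = (2 *s (e \<bullet> x)) \<bullet> (2 *s (e \<bullet> y)) + 2 *s (e \<bullet> (x \<bullet> y)) - x \<bullet> y" for x y
  have zero: "B x x = 0" if "x \<in> barideal" for x
    using bernstein_expansion(2)[OF that] by (simp add: B_def mult_simps)
  have "B (n + m) (n + m) = B n n + B m m + (B n m + B m n)"
    unfolding B_def by (simp add: mult_simps scale_right_distrib algebra_simps)
  moreover have "B m n = B n m"
    unfolding B_def by (metis mult_commute)
  ultimately have "B n m + B n m = 0"
    using zero assms subspace_add[OF subspace_barideal] by simp
  then have "B n m = 0" by (rule twice_eq_0)
  then show ?thesis by (simp add: B_def)
qed

lemma mult_UU: "u \<in> U \<Longrightarrow> u' \<in> U \<Longrightarrow> u \<bullet> u' \<in> V"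
  and mult_UV: "u \<in> U \<Longrightarrow> v \<in> V \<Longrightarrow> u \<bullet> v \<in> U"
  and mult_VV: "v \<in> V \<Longrightarrow> v' \<in> V \<Longrightarrow> v \<bullet> v' \<in> U"
  using square_expansion_polarized[OF U_barideal U_barideal, of u u']
    square_expansion_polarized[OF U_barideal V_barideal, of u v]
    square_expansion_polarized[OF V_barideal V_barideal, of v v'] two
  by (auto simp: U_def V_def weight_mult mult_simps)

text \<open>
  The third identity of \<open>bernstein_expansion\<close> at \<open>u + v\<close> reads \<open>u (u + v)\<^sup>2 = 0\<close>. Its parts of
  degree \<open>0\<close>, \<open>1\<close> and \<open>2\<close> in \<open>v\<close> vanish separately, as the substitutions of \<open>0\<close>, \<open>v\<close> and \<open>- v\<close> show.
\<close>

lemma cubic_identities: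
  assumes u: "u \<in> U" and v: "v \<in> V"
  shows "u \<bullet> (u \<bullet> v) = 0" and "u \<bullet> (v \<bullet> v) = 0"
proof -
  have cubic: "u \<bullet> ((u + w) \<bullet> (u + w)) = 0" if w: "w \<in> V" for w
  proof -
    have "u + w \<in> barideal"
      using u w U_barideal V_barideal subspace_add[OF subspace_barideal] by blast
    then have "2 *s ((e \<bullet> (u + w)) \<bullet> ((u + w) \<bullet> (u + w))) = 0"
      using bernstein_expansion(3) by simp
    moreover have "2 *s (e \<bullet> (u + w)) = u"
      using u w by (simp add: U_def V_def mult_simps)
    ultimately show ?thesis by (metis right.scale)
  qed
  define a b c where "a = u \<bullet> (u \<bullet> u)" and "b = u \<bullet> (u \<bullet> v)" and "c = u \<bullet> (v \<bullet> v)"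
  have 0: "a = 0" using cubic[of 0] subspace_0[OF subspace_V] by (simp add: a_def)
  have plus: "b + b + c = 0"
    using cubic[OF v] 0 by (simp add: mult_simps a_def b_def c_def mult_commute[of v u] ac_simps)
  have minus: "- b - b + c = 0"
    using cubic[of "- v"] v V_closed 0
    by (simp add: mult_simps a_def b_def c_def mult_commute[of v u] algebra_simps)
  have "c + c = (b + b + c) + (- b - b + c)" by (simp add: algebra_simps)
  then have "c = 0" using plus minus by (metis add_0_left twice_eq_0)
  moreover from this have "b = 0" using plus by (metis add_0_right twice_eq_0)
  ultimately show "u \<bullet> (u \<bullet> v) = 0" "u \<bullet> (v \<bullet> v) = 0" by (simp_all add: b_def c_def)
qed

lemma U_VV_zero:
  assumes "u \<in> U" "v \<in> V" "v' \<in> V"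
  shows "u \<bullet> (v \<bullet> v') = 0"
proof (rule twice_eq_0)
  have "u \<bullet> ((v + v') \<bullet> (v + v')) = 0" "u \<bullet> (v \<bullet> v) = 0" "u \<bullet> (v' \<bullet> v') = 0"
    using assms cubic_identities(2) V_closed by auto
  then show "u \<bullet> (v \<bullet> v') + u \<bullet> (v \<bullet> v') = 0"
    by (simp add: mult_simps mult_commute[of v' v])
qed

lemma UUV_skew:
  assumes "u \<in> U" "u' \<in> U" "v \<in> V"
  shows "u \<bullet> (u' \<bullet> v) = - (u' \<bullet> (u \<bullet> v))"
proof -
  have "(u + u') \<bullet> ((u + u') \<bullet> v) = 0" "u \<bullet> (u \<bullet> v) = 0" "u' \<bullet> (u' \<bullet> v) = 0"
    using assms cubic_identities(1) U_closed by auto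
  then show ?thesis by (simp add: mult_simps eq_neg_iff_add_eq_0 add.commute)
qed

text \<open>
  The part of \<open>((u + v)\<^sup>2)\<^sup>2 = 0\<close> that is quadratic in \<open>u\<close> and in \<open>v\<close> is
  \<open>4 (u v)\<^sup>2 + 2 u\<^sup>2 v\<^sup>2 = 0\<close>. The first summand lies in \<open>V\<close> and the second one in \<open>U\<close>, so both vanish.
\<close>

lemma UV_square_zero:
  assumes u: "u \<in> U" and v: "v \<in> V"
  shows "(u \<bullet> v) \<bullet> (u \<bullet> v) = 0"
proof -
  have quartic: "((u + w) \<bullet> (u + w)) \<bullet> ((u + w) \<bullet> (u + w)) = 0" if w: "w \<in> V" for w
    using u w U_barideal V_barideal subspace_add[OF subspace_barideal] bernstein_expansion(4) by blast
  define p q r where "p = u \<bullet> u" and "q = u \<bullet> v" and "r = v \<bullet> v"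
  have pV: "p \<in> V" and qU: "q \<in> U" and rU: "r \<in> U"
    using u v mult_UU mult_UV mult_VV by (auto simp: p_def q_def r_def)
  have pp: "p \<bullet> p = 0" using bernstein_expansion(4)[OF U_barideal[OF u]] by (simp add: p_def)
  have rr: "r \<bullet> r = 0" using bernstein_expansion(4)[OF V_barideal[OF v]] by (simp add: r_def)
  have qr: "q \<bullet> r = 0" unfolding r_def by (rule U_VV_zero[OF qU v v])
  have "(u + v) \<bullet> (u + v) = p + 2 *s q + r"
    using square_sum3[of u v 0] by (simp add: mult_simps p_def q_def r_def)
  then have plus: "4 *s (q \<bullet> q) + 4 *s (p \<bullet> q) + 2 *s (p \<bullet> r) = 0"
    using quartic[OF v] square_sum3[of p "2 *s q" r] pp rr qr by (simp add: mult_simps)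
  have "(u + - v) \<bullet> (u + - v) = p + - (2 *s q) + r"
    using square_sum3[of u "- v" 0] by (simp add: mult_simps p_def q_def r_def)
  then have minus: "4 *s (q \<bullet> q) - 4 *s (p \<bullet> q) + 2 *s (p \<bullet> r) = 0"
    using quartic[of "- v"] v V_closed square_sum3[of p "- (2 *s q)" r] pp rr qr
    by (simp add: mult_simps)
  have "4 *s (q \<bullet> q) + 2 *s (p \<bullet> r) = 0"
  proof (rule twice_eq_0)
    show "(4 *s (q \<bullet> q) + 2 *s (p \<bullet> r)) + (4 *s (q \<bullet> q) + 2 *s (p \<bullet> r)) = 0"
      using arg_cong2[OF plus minus, of "(+)"] by (simp add: algebra_simps)
  qed
  then have eq: "4 *s (q \<bullet> q) = - (2 *s (p \<bullet> r))" by (simp add: eq_neg_iff_add_eq_0)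
  have "4 *s (q \<bullet> q) \<in> V" using mult_UU[OF qU qU] V_closed by blast
  moreover have "4 *s (q \<bullet> q) \<in> U"
    unfolding eq using mult_UV[OF rU pV] U_closed by (simp add: mult_commute[of p r])
  ultimately have "4 *s (q \<bullet> q) = 0" by (rule U_Int_V[rotated])
  then show ?thesis using four by (simp add: q_def)
qed

lemma UV_UV_skew:
  assumes "u \<in> U" "u' \<in> U" "v \<in> V" "v' \<in> V"
  shows "(u \<bullet> v) \<bullet> (u' \<bullet> v') + (u \<bullet> v') \<bullet> (u' \<bullet> v) = 0"
proof -
  have *: "(a \<bullet> w) \<bullet> (b \<bullet> w) = 0" if "a \<in> U" "b \<in> U" "w \<in> V" for a b w
  proof (rule twice_eq_0)
    have "((a + b) \<bullet> w) \<bullet> ((a + b) \<bullet> w) = 0" "(a \<bullet> w) \<bullet> (a \<bullet> w) = 0" "(b \<bullet> w) \<bullet> (b \<bullet> w) = 0"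
      using that UV_square_zero U_closed by auto
    then show "(a \<bullet> w) \<bullet> (b \<bullet> w) + (a \<bullet> w) \<bullet> (b \<bullet> w) = 0"
      by (simp add: mult_simps mult_commute[of "b \<bullet> w" "a \<bullet> w"])
  qed
  have "(u \<bullet> (v + v')) \<bullet> (u' \<bullet> (v + v')) = 0" "(u \<bullet> v) \<bullet> (u' \<bullet> v) = 0" "(u \<bullet> v') \<bullet> (u' \<bullet> v') = 0"
    using assms * V_closed by auto
  then show ?thesis by (simp add: mult_simps add.commute)
qed

section \<open>Multiplication by V modulo the annihilator of U\<close>

definition annU :: "'a set" where "annU = {l \<in> U. \<forall>u\<in>U. u \<bullet> l = 0}"

lemma annU_U: "l \<in> annU \<Longrightarrow> l \<in> U" by (simp add: annU_def)

lemma subspace_annU: "subspace annU"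
  using subspace_U by (auto simp: annU_def subspace_def mult_simps)

lemma mult_VV_annU: "v \<in> V \<Longrightarrow> v' \<in> V \<Longrightarrow> v \<bullet> v' \<in> annU"
  using mult_VV U_VV_zero by (simp add: annU_def)

lemma mult_annU_annU: "l \<in> annU \<Longrightarrow> l' \<in> annU \<Longrightarrow> l \<bullet> l' = 0"
  by (simp add: annU_def)

text \<open>
  By \<open>UUV_skew\<close>, a factor from \<open>V\<close> can be moved away from \<open>l\<close> onto the other factor from \<open>U\<close>.
\<close>

lemma mult_annU_V:
  assumes "l \<in> annU" "v \<in> V"
  shows "l \<bullet> v \<in> annU"
proof -
  have "u \<bullet> (l \<bullet> v) = 0" if "u \<in> U" for u
    using UUV_skew[OF that annU_U[OF assms(1)] assms(2)] assms that mult_UV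
    by (simp add: annU_def mult_commute[of l])
  then show ?thesis using assms mult_UV by (simp add: annU_def)
qed

text \<open>
  Multiplying by \<open>w \<in> U\<close> and moving the outer factor from \<open>V\<close> onto \<open>w\<close> turns this sum into the
  expression of \<open>UV_UV_skew\<close>.
\<close>

lemma right_mult_V_skew_mod_annU:
  assumes "u \<in> U" "v \<in> V" "v' \<in> V"
  shows "(u \<bullet> v) \<bullet> v' + (u \<bullet> v') \<bullet> v \<in> annU"
proof -
  have "w \<bullet> ((u \<bullet> v) \<bullet> v' + (u \<bullet> v') \<bullet> v) = 0" if w: "w \<in> U" for w
  proof -
    have "w \<bullet> ((u \<bullet> v) \<bullet> v') = - ((u \<bullet> v) \<bullet> (w \<bullet> v'))"
      "w \<bullet> ((u \<bullet> v') \<bullet> v) = - ((u \<bullet> v') \<bullet> (w \<bullet> v))"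
      by (rule UUV_skew[OF w mult_UV[OF assms(1,2)] assms(3)],
          rule UUV_skew[OF w mult_UV[OF assms(1,3)] assms(2)])
    then have "w \<bullet> ((u \<bullet> v) \<bullet> v' + (u \<bullet> v') \<bullet> v)
        = - ((u \<bullet> v) \<bullet> (w \<bullet> v') + (u \<bullet> v') \<bullet> (w \<bullet> v))"
      by (simp only: left.add minus_add_distrib)
    then show ?thesis
      using UV_UV_skew[OF assms(1) w assms(2,3)] by simp
  qed
  then show ?thesis using assms mult_UV U_closed by (simp add: annU_def)
qed

lemma right_mult_V_square_mod_annU:
  assumes "u \<in> U" "v \<in> V"
  shows "(u \<bullet> v) \<bullet> v \<in> annU"
proof -
  have "2 *s ((u \<bullet> v) \<bullet> v) \<in> annU"
    using right_mult_V_skew_mod_annU[OF assms(1) assms(2,2)] scale_left_distrib[of 1 1] by simp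
  from subspace_scale[OF subspace_annU this, of "1/2"] show ?thesis using two by simp
qed

text \<open>
  This is the step that replaces Nakayama's lemma. Multiplying the hypothesis for \<open>insert g G\<close> by \<open>g\<close>
  bounds \<open>U g\<close> by \<open>annU g\<close>, \<open>(U g) g\<close> and the spaces \<open>(U h) g\<close> with \<open>h \<in> G\<close>. The first two lie in
  \<open>annU\<close>, and \<open>(U h) g\<close> lies in \<open>(U g) h + annU \<subseteq> U h + annU\<close>. So \<open>U g\<close> is, up to finitely many
  dimensions, already spanned by \<open>annU\<close> and the spaces \<open>U h\<close>, and \<open>g\<close> can be dropped.
\<close>

lemma finite_modulo_eliminate:
  assumes "finite G" "G \<subseteq> V" "finite_modulo U (annU \<union> (\<Union>g\<in>G. (\<lambda>u. u \<bullet> g) ` U))"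
  shows "finite_modulo U annU"
  using assms
proof (induction G rule: finite_induct)
  case empty
  then show ?case by simp
next
  case (insert g G)
  let ?R = "\<lambda>g. (\<lambda>u. u \<bullet> g) ` U"
  let ?Y = "annU \<union> (\<Union>g\<in>G. ?R g)"
  have g: "g \<in> V" and G: "G \<subseteq> V" using insert.prems by auto
  have image: "finite_modulo (?R g) ((\<lambda>u. u \<bullet> g) ` (annU \<union> (\<Union>h\<in>insert g G. ?R h)))"
    using finite_modulo_image[OF insert.prems(2) linear_mult_left[of g]] .
  have "(\<lambda>u. u \<bullet> g) ` (annU \<union> (\<Union>h\<in>insert g G. ?R h)) \<subseteq> span ?Y"
  proof (intro image_subsetI)
    fix x assume "x \<in> annU \<union> (\<Union>h\<in>insert g G. ?R h)"
    then consider "x \<in> annU" | u where "u \<in> U" "x = u \<bullet> g" | u h where "u \<in> U" "h \<in> G" "x = u \<bullet> h"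
      by auto
    then show "x \<bullet> g \<in> span ?Y"
    proof cases
      case 1
      then have "x \<bullet> g \<in> annU" using mult_annU_V g by blast
      then show ?thesis by (intro span_base) blast
    next
      case 2
      then have "x \<bullet> g \<in> annU" using right_mult_V_square_mod_annU g by blast
      then show ?thesis by (intro span_base) blast
    next
      case 3
      have "(u \<bullet> h) \<bullet> g + (u \<bullet> g) \<bullet> h \<in> span ?Y"
        using right_mult_V_skew_mod_annU[of u h g] 3 g G by (intro span_base) blast
      moreover have "(u \<bullet> g) \<bullet> h \<in> span ?Y"
        using 3(2) mult_UV[OF 3(1) g] by (intro span_base) blast
      ultimately have "((u \<bullet> h) \<bullet> g + (u \<bullet> g) \<bullet> h) - (u \<bullet> g) \<bullet> h \<in> span ?Y"
        by (rule span_diff)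
      then show ?thesis using 3 by simp
    qed
  qed
  then have "finite_modulo (?R g) ?Y"
    using finite_modulo_trans[OF image finite_modulo_span] by simp
  moreover have "finite_modulo ?Y ?Y" by (rule finite_modulo_span) (rule span_superset)
  ultimately have "finite_modulo (?R g \<union> ?Y) ?Y" by (rule finite_modulo_Un)
  moreover have "annU \<union> (\<Union>h\<in>insert g G. ?R h) = ?R g \<union> ?Y" by auto
  ultimately have "finite_modulo U ?Y"
    using finite_modulo_trans[OF insert.prems(2)] by simp
  then show ?case using insert.IH G by blast
qed

section \<open>Chain conditions and finite dimension\<close>

lemma finite_dimensionalI:
  assumes "finite_modulo UNIV {}"
  shows "finite_dimensional"
proof -
  obtain F where F: "finite F" "span F = UNIV"
    using assms unfolding finite_modulo_def by auto
  obtain B where B: "B \<subseteq> F" "independent B" "F \<subseteq> span B"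
    using maximal_independent_subset by blast
  have "span B = UNIV" using F(2) B(3) span_minimal[OF _ subspace_span] by blast
  then have "finite_dimensional_vector_space scale B"
    using B F(1) finite_subset by unfold_locales auto
  then show ?thesis unfolding finite_dimensional_def by blast
qed

lemma chain_condition_imp_finite_dimensional:
  defines "\<F> \<equiv> {S. subalgebra S \<and> S \<subseteq> barideal}"
  assumes chain: "ascending_chain_condition \<F> \<or> descending_chain_condition \<F>"
  shows finite_dimensional
proof -
  note section_finite = chain_condition_imp_finite_modulo[where \<F> = \<F>, OF _ _ _ _ chain]
  \<comment> \<open>First zero section: products in \<open>annU\<close> vanish.\<close>
  have "finite_modulo annU {0}"
  proof (rule section_finite)
    fix T assume T: "subspace T" "T \<subseteq> annU"
    then have "x \<bullet> y \<in> T" if "x \<in> T" "y \<in> T" for x y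
      using that mult_annU_annU subspace_0[OF T(1)] by (metis subsetD)
    then show "T \<in> \<F>" using T annU_U U_barideal by (auto simp: \<F>_def subalgebra_def)
  qed (simp_all add: subspace_annU subspace_0)
  then have annU: "finite_modulo annU {}"
    unfolding finite_modulo_def by (metis Un_insert_right span_insert_0)

  \<comment> \<open>Second zero section: all products in \<open>annU + V\<close> lie in \<open>annU\<close>.\<close>
  let ?S = "{l + v |l v. l \<in> annU \<and> v \<in> V}"
  have S: "finite_modulo ?S annU"
  proof (rule section_finite)
    show "annU \<subseteq> ?S" using subspace_0[OF subspace_V] by force
    show "subspace ?S" by (rule subspace_sums[OF subspace_annU subspace_V])
    fix T assume T: "subspace T" "annU \<subseteq> T" "T \<subseteq> ?S"
    have "x \<bullet> y \<in> T" if xy: "x \<in> T" "y \<in> T" for x y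
    proof -
      obtain l v l' v' where *: "l \<in> annU" "v \<in> V" "x = l + v" "l' \<in> annU" "v' \<in> V" "y = l' + v'"
        using xy T(3) by blast
      have "x \<bullet> y = l \<bullet> v' + l' \<bullet> v + v \<bullet> v'"
        using * mult_annU_annU by (simp add: mult_simps mult_commute[of v l'] ac_simps)
      also have "\<dots> \<in> annU" using * mult_annU_V mult_VV_annU subspace_add[OF subspace_annU] by simp
      finally show ?thesis using T(2) by blast
    qed
    moreover have "T \<subseteq> barideal"
      using T(3) annU_U U_barideal V_barideal subspace_add[OF subspace_barideal] by blast
    ultimately show "T \<in> \<F>" using T(1) by (simp add: \<F>_def subalgebra_def)
  qed (simp add: subspace_annU)
  have "V \<subseteq> ?S" using subspace_0[OF subspace_annU] by force
  then have "V \<subseteq> span ?S" using span_superset by (rule order_trans)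
  then have V: "finite_modulo V {}"
    by (rule finite_modulo_trans[OF finite_modulo_span finite_modulo_trans[OF S annU]])
  obtain G where G: "G \<subseteq> V" "independent G" "V \<subseteq> span G"
    using maximal_independent_subset by blast
  obtain F where "finite F" "V \<subseteq> span F" using V unfolding finite_modulo_def by auto
  then have "finite G" using independent_span_bound[of F G] G by blast

  let ?Y = "annU \<union> (\<Union>g\<in>G. (\<lambda>u. u \<bullet> g) ` U)"
  have UV: "u \<bullet> v \<in> span ?Y" if "u \<in> U" "v \<in> V" for u v
  proof -
    have "u \<bullet> v \<in> span ((\<lambda>y. u \<bullet> y) ` G)"
      using that G(3) left.span_image[of u G] by blast
    also have "\<dots> \<subseteq> span ?Y" using that by (intro span_mono) auto
    finally show ?thesis .
  qed

  \<comment> \<open>Third zero section: \<open>barideal\<close> over the span of its products.\<close>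
  let ?Q = "{x \<bullet> y |x y. x \<in> barideal \<and> y \<in> barideal}"
  have Q: "?Q \<subseteq> barideal" by (auto simp: weight_barideal weight_mult)
  have N: "finite_modulo barideal (span ?Q)"
  proof (rule section_finite)
    show "span ?Q \<subseteq> barideal" by (rule span_minimal[OF Q subspace_barideal])
    fix T assume T: "subspace T" "span ?Q \<subseteq> T" "T \<subseteq> barideal"
    have "x \<bullet> y \<in> T" if "x \<in> T" "y \<in> T" for x y
    proof -
      have "x \<in> barideal" "y \<in> barideal" using that T(3) by auto
      then have "x \<bullet> y \<in> ?Q" by blast
      then show ?thesis by (rule subsetD[OF T(2) span_base])
    qed
    then show "T \<in> \<F>" using T(1,3) by (simp add: \<F>_def subalgebra_def)
  qed (simp_all only: subspace_barideal subspace_span)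
  have N: "finite_modulo barideal ?Q"
    by (rule finite_modulo_trans[OF N finite_modulo_span[OF order_refl]])
  \<comment> \<open>Projecting to \<open>U\<close> along \<open>V\<close> kills the part of a product that comes from \<open>U U\<close>,
    and the part from \<open>V V\<close> lies in \<open>annU\<close>; only \<open>U V\<close> remains.\<close>
  define \<pi> where "\<pi> x = 2 *s (e \<bullet> x)" for x
  have "Vector_Spaces.linear scale scale \<pi>"
    unfolding \<pi>_def
    by unfold_locales (simp_all add: mult_simps scale_right_distrib scale_left_commute)
  then have \<pi>N: "finite_modulo (\<pi> ` barideal) (\<pi> ` ?Q)"
    by (rule finite_modulo_image[OF N])
  have \<pi>Q: "\<pi> ` ?Q \<subseteq> span ?Y"
  proof clarify
    fix x y assume "x \<in> barideal" "y \<in> barideal"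
    then obtain u v u' v' where *: "u \<in> U" "v \<in> V" "x = u + v" "u' \<in> U" "v' \<in> V" "y = u' + v'"
      using Peirce_split by metis
    have "\<pi> a = a" if "a \<in> U" for a using that by (simp add: \<pi>_def U_def)
    moreover have "\<pi> a = 0" if "a \<in> V" for a using that by (simp add: \<pi>_def V_def)
    moreover have "\<pi> (a + b) = \<pi> a + \<pi> b" for a b
      by (simp add: \<pi>_def mult_simps scale_right_distrib)
    moreover have "x \<bullet> y = u \<bullet> u' + (u \<bullet> v' + u' \<bullet> v + v \<bullet> v')"
      using * by (simp add: mult_simps mult_commute[of v u'] ac_simps)
    ultimately have "\<pi> (x \<bullet> y) = u \<bullet> v' + u' \<bullet> v + v \<bullet> v'"
      using * mult_UU mult_UV mult_VV by simp
    also have "\<dots> \<in> span ?Y"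
      using * UV mult_VV_annU by (intro span_add) (auto intro: span_base)
    finally show "\<pi> (x \<bullet> y) \<in> span ?Y" .
  qed
  have "U \<subseteq> \<pi> ` barideal"
  proof
    fix u assume "u \<in> U"
    then have "u = \<pi> u" "u \<in> barideal" by (simp_all add: \<pi>_def U_def weight_barideal)
    then show "u \<in> \<pi> ` barideal" by blast
  qed
  then have "U \<subseteq> span (\<pi> ` barideal)" using span_superset by (rule order_trans)
  then have "finite_modulo U ?Y"
    by (rule finite_modulo_trans[OF finite_modulo_span
          finite_modulo_trans[OF \<pi>N finite_modulo_span[OF \<pi>Q]]])
  then have "finite_modulo U annU"
    using finite_modulo_eliminate[OF \<open>finite G\<close> G(1)] by blast
  then have U: "finite_modulo U {}" by (rule finite_modulo_trans[OF _ annU])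

  have "finite_modulo {e} {}"
    unfolding finite_modulo_def by (rule exI[of _ "{e}"]) (simp add: span_base)
  then have sum: "finite_modulo ({e} \<union> (U \<union> V)) {}"
    using finite_modulo_Un U V by blast
  have "x \<in> span ({e} \<union> (U \<union> V))" for x
  proof -
    have "x - \<omega> x *s e \<in> barideal"
      by (simp add: weight_barideal weight.diff weight.scale weight_e)
    then obtain u v where "u \<in> U" "v \<in> V" "x - \<omega> x *s e = u + v" by (rule Peirce_split)
    then have "x = \<omega> x *s e + (u + v)" by (simp add: algebra_simps)
    then show ?thesis
      using \<open>u \<in> U\<close> \<open>v \<in> V\<close> by (metis UnCI insertCI span_add span_base span_scale)
  qed
  then have "UNIV \<subseteq> span ({e} \<union> (U \<union> V))" by blast
  then have "finite_modulo UNIV {}"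
    by (rule finite_modulo_trans[OF finite_modulo_span sum])
  then show ?thesis by (rule finite_dimensionalI)
qed

end

lemma (in nonassoc_algebra) finite_dimensional_imp_chain_conditions:
  assumes finite_dimensional and "\<F> \<subseteq> {S. subalgebra S}"
  shows "ascending_chain_condition \<F>" "descending_chain_condition \<F>"
proof -
  obtain B where "finite_dimensional_vector_space scale B"
    using assms(1) unfolding finite_dimensional_def by blast
  then interpret fd: finite_dimensional_vector_space scale B .
  have "subspace S" if "S \<in> \<F>" for S using that assms(2) by (auto simp: subalgebra_def)
  then show "ascending_chain_condition \<F>" "descending_chain_condition \<F>"
    using fd.subspace_chain_conditions by blast+
qed

text \<open>
  For \<open>\<omega> x = 1\<close> the defining identity says that \<open>x\<^sup>2\<close> is idempotent.
\<close>

lemma (in bernstein_algebra) exists_idempotent: "\<exists>e. e \<bullet> e = e \<and> \<omega> e = 1"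
proof -
  interpret weight: Vector_Spaces.linear scale "(*)" \<omega> by (rule linear_weight)
  obtain y where y: "\<omega> y \<noteq> 0" using weight_nonzero by blast
  define x where "x = inverse (\<omega> y) *s y"
  have "\<omega> x = 1" using y by (simp add: x_def weight.scale)
  then have "(x \<bullet> x) \<bullet> (x \<bullet> x) = x \<bullet> x \<and> \<omega> (x \<bullet> x) = 1"
    using bernstein[of x] by (simp add: weight_mult)
  then show ?thesis by blast
qed

lemma chain_condition_subset:
  assumes "\<F> \<subseteq> \<G>"
  shows "ascending_chain_condition \<G> \<Longrightarrow> ascending_chain_condition \<F>"
    and "descending_chain_condition \<G> \<Longrightarrow> descending_chain_condition \<F>"
  using subsetD[OF assms]
  unfolding ascending_chain_condition_def descending_chain_condition_def by metis+

theorem theorem2p1: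
  fixes scale :: "'k::field \<Rightarrow> 'a::ab_group_add \<Rightarrow> 'a"
    and mult :: "'a \<Rightarrow> 'a \<Rightarrow> 'a"
    and weight :: "'a \<Rightarrow> 'k"
  defines "subalg \<equiv> nonassoc_algebra.subalgebra scale mult"
    and "N \<equiv> baric_algebra.barideal weight"
    and "findim \<equiv> nonassoc_algebra.finite_dimensional scale"
  assumes "infinite (UNIV :: 'k set)"
    and "CHAR('k) \<noteq> 2" and "CHAR('k) \<noteq> 3"
    and "bernstein_algebra scale mult weight"
  shows "(ascending_chain_condition {S. subalg S} \<longleftrightarrow>
            ascending_chain_condition {S. subalg S \<and> S \<subseteq> N}) \<and>
         (ascending_chain_condition {S. subalg S \<and> S \<subseteq> N} \<longleftrightarrow> findim) \<and>
         (descending_chain_condition {S. subalg S} \<longleftrightarrow>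
            descending_chain_condition {S. subalg S \<and> S \<subseteq> N}) \<and>
         (descending_chain_condition {S. subalg S \<and> S \<subseteq> N} \<longleftrightarrow> findim)"
proof -
  interpret bernstein_algebra scale mult weight by fact
  obtain e where e: "mult e e = e" "weight e = 1" using exists_idempotent by blast
  have char: "CHAR('k) = p" if "prime p" "(of_nat p :: 'k) = 0" for p
  proof -
    have "CHAR('k) dvd p" using that(2) by (simp only: of_nat_eq_0_iff_char_dvd)
    then have "CHAR('k) = 1 \<or> CHAR('k) = p" using that(1) unfolding prime_nat_iff by blast
    then show ?thesis using CHAR_not_1'[where 'a = 'k] by simp
  qed
  have "(2::'k) \<noteq> 0" "(3::'k) \<noteq> 0"
    using char[of 2] char[of 3] assms(5,6) by auto
  then interpret bernstein_idempotent scale mult weight e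
    using e by unfold_locales
  let ?All = "{S. subalg S}" and ?InN = "{S. subalg S \<and> S \<subseteq> N}"
  have "findim" if "ascending_chain_condition ?InN \<or> descending_chain_condition ?InN"
    using chain_condition_imp_finite_dimensional that
    unfolding subalg_def N_def findim_def .
  moreover have "ascending_chain_condition ?All" "descending_chain_condition ?All" if findim
    using finite_dimensional_imp_chain_conditions[OF _ order_refl] that
    unfolding subalg_def findim_def by simp_all
  moreover have "?InN \<subseteq> ?All" by blast
  note chain_condition_subset[OF this]
  ultimately show ?thesis by argo
qed

end
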